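(* There exists a 2-dimensional pseudo billiard generated by a discontinuous map $T$ such that it has both strongly chaotic and neutral components of transitivity.
   Context: A pseudo billiard is the dynamics of a particle moving with constant velocity inside a given region (not necessarily a polyhedron) and changing its velocity instantaneously, at the moment of a collision with the boundary, to the velocity defined by a given vector field (not necessarily constant) on the boundary. It is 2-dimensional if the region lies in $\mathbb{R}^2$. For a polygonal region, $X$ denotes the union of its sides, and $T:X\to X$ is the first return (Poincaré) map: $Tx$ is the next intersection with $X$ of the trajectory starting at $x$. Strong Markov partition: a partition of $X$ into connected components $X_i$ with piecewise smooth boundaries such that $\bigcup_iX_i=X$; $\mathrm{Int}(X_i)\cap\mathrm{Int}(X_j)=\emptyset$ for $i\ne j$; each $TX_i$ is a union of elements $X_j$; and $T|_{X_i}$ is a homeomorphism for each $i$. Components of transitivity: two elements $X_i,X_j$ of the Markov partition belong to the same component of transitivity if there is a positive integer $n$ such that $\mathrm{Int}(T^nX_i\cap X_j)\ne\emptyset$. A component is strongly chaotic if the restriction of $T$ to it has an invariant measure absolutely continuous with respect to Lebesgue measure on $X$; it is neutral if each trajectory in it is eventually periodic. *)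

theory Defs
  imports "HOL-Analysis.Analysis"
begin

section \<open>Pseudo billiards\<close>

text \<open>
  A pseudo billiard consists of a region \<open>D\<close> and a vector field \<open>v\<close> on its boundary.
  The velocity prescribed at a boundary point has to send the particle into the region,
  so that the motion between two collisions takes place inside \<open>D\<close>.
  No continuity of \<open>v\<close> is assumed.
\<close>

definition pseudo_billiard :: "'a::euclidean_space set \<Rightarrow> ('a \<Rightarrow> 'a) \<Rightarrow> bool" where
  "pseudo_billiard D v \<longleftrightarrow>
     open D \<and> connected D \<and> D \<noteq> {} \<and>
     (\<forall>x\<in>frontier D. \<forall>\<^sub>F t in at_right 0. x + t *\<^sub>R v x \<in> D)"

text \<open>
  If \<open>v x\<close> points into a bounded region with boundary \<open>X\<close>, the infimum below is a minimum.
\<close>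

definition return_time :: "'a::euclidean_space set \<Rightarrow> ('a \<Rightarrow> 'a) \<Rightarrow> 'a \<Rightarrow> real" where
  "return_time X v x = Inf {t. 0 < t \<and> x + t *\<^sub>R v x \<in> X}"

definition first_return :: "'a::euclidean_space set \<Rightarrow> ('a \<Rightarrow> 'a) \<Rightarrow> 'a \<Rightarrow> 'a" where
  "first_return X v x = x + return_time X v x *\<^sub>R v x"

section \<open>Polygons\<close>

text \<open>A polygon is given by the cyclic list of its vertices.\<close>

definition side :: "'a::euclidean_space list \<Rightarrow> nat \<Rightarrow> 'a set" where
  "side ps i = closed_segment (ps ! i) (ps ! (Suc i mod length ps))"

definition sides_union :: "'a::euclidean_space list \<Rightarrow> 'a set" where
  "sides_union ps = (\<Union>i<length ps. side ps i)"

text \<open>Distinct sides of a simple polygon meet only in common end points.\<close>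

definition simple_polygon :: "(real^2) list \<Rightarrow> bool" where
  "simple_polygon ps \<longleftrightarrow>
     3 \<le> length ps \<and> distinct ps \<and>
     (\<forall>i<length ps. \<forall>j<length ps. i \<noteq> j \<longrightarrow>
        side ps i \<inter> side ps j =
          {ps ! i, ps ! (Suc i mod length ps)} \<inter> {ps ! j, ps ! (Suc j mod length ps)})"

text \<open>The bounded component of the complement of the closed polygonal curve.\<close>

definition polygon_region :: "(real^2) list \<Rightarrow> (real^2) set" where
  "polygon_region ps = inside (sides_union ps)"

text \<open>
  One-dimensional Lebesgue measure (length) on the union of the sides, as a Borel measure on
  the ambient space. The summand is the length of the part of the \<open>i\<close>-th side that lies in \<open>A\<close>.
\<close>

definition length_measure :: "'a::euclidean_space list \<Rightarrow> 'a measure" where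
  "length_measure ps = measure_of UNIV (sets borel)
     (\<lambda>A. \<Sum>i<length ps. ennreal (dist (ps ! i) (ps ! (Suc i mod length ps))) *
        emeasure lborel {t \<in> {0..1}. linepath (ps ! i) (ps ! (Suc i mod length ps)) t \<in> A})"

lemma space_length_measure [simp]: "space (length_measure ps) = UNIV"
  unfolding length_measure_def by (rule space_measure_of) simp

lemma sets_length_measure [simp]: "sets (length_measure ps) = sets borel"
  unfolding length_measure_def
  by (rule sigma_algebra.sets_measure_of_eq) (metis sets.sigma_algebra_axioms space_borel)

lemma emeasure_length_measure:
  assumes "A \<in> sets borel"
  shows "emeasure (length_measure ps) A =
    (\<Sum>i<length ps. ennreal (dist (ps ! i) (ps ! (Suc i mod length ps))) *
        emeasure lborel {t \<in> {0..1}. linepath (ps ! i) (ps ! (Suc i mod length ps)) t \<in> A})"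
    (is "_ = ?m A")
proof (rule emeasure_measure_of[OF length_measure_def])
  show "sets borel \<subseteq> Pow (UNIV :: 'a set)" by simp
  show "A \<in> sets (length_measure ps)" using assms by simp
  show "positive (sets (length_measure ps)) ?m"
    by (simp add: positive_def)
  show "countably_additive (sets (length_measure ps)) ?m"
  proof (rule countably_additiveI)
    fix F :: "nat \<Rightarrow> 'a set"
    assume F: "range F \<subseteq> sets (length_measure ps)" and disj: "disjoint_family F"
    let ?P = "\<lambda>i S. {t \<in> {0..1}. linepath (ps ! i) (ps ! (Suc i mod length ps)) t \<in> S}"
    have meas: "?P i (F n) \<in> sets lborel" for i n
    proof -
      have "linepath (ps ! i) (ps ! (Suc i mod length ps)) \<in> borel_measurable borel"
        by (intro borel_measurable_continuous_onI continuous_on_linepath)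
      moreover have "F n \<in> sets borel" using F by auto
      ultimately have "linepath (ps ! i) (ps ! (Suc i mod length ps)) -` F n \<in> sets borel"
        by (metis inf_top_right measurable_sets space_borel)
      then have "{0..1} \<inter> linepath (ps ! i) (ps ! (Suc i mod length ps)) -` F n \<in> sets lborel"
        by simp
      then show ?thesis by (simp add: Int_def vimage_def)
    qed
    have "(\<Sum>n. ?m (F n)) =
      (\<Sum>i<length ps. \<Sum>n. ennreal (dist (ps ! i) (ps ! (Suc i mod length ps))) *
         emeasure lborel (?P i (F n)))"
      by (rule suminf_sum) simp
    also have "\<dots> = ?m (\<Union>n. F n)"
    proof (rule sum.cong[OF refl])
      fix i
      have "(\<Sum>n. emeasure lborel (?P i (F n))) = emeasure lborel (\<Union>n. ?P i (F n))"
        by (rule suminf_emeasure) (use meas disj in \<open>auto simp: disjoint_family_on_def disjoint_iff\<close>)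
      also have "(\<Union>n. ?P i (F n)) = ?P i (\<Union>n. F n)" by auto
      finally show "(\<Sum>n. ennreal (dist (ps ! i) (ps ! (Suc i mod length ps))) *
          emeasure lborel (?P i (F n))) =
        ennreal (dist (ps ! i) (ps ! (Suc i mod length ps))) * emeasure lborel (?P i (\<Union>n. F n))"
        by simp
    qed
    finally show "(\<Sum>n. ?m (F n)) = ?m (\<Union>n. F n)" .
  qed
qed

section \<open>Strong Markov partitions\<close>

text \<open>
  Interiors and boundaries are taken relative to \<open>X\<close>. As \<open>X\<close> is one-dimensional, a piecewise
  smooth boundary of an element is a finite set of points. Elements need not be closed; indeed,
  a finite partition into closed elements would force \<open>T\<close> to be continuous. Elements
  with empty interior (single points) are excluded: they would be components of transitivity
  of their own.
\<close>

definition strong_Markov_partition ::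
  "'a::topological_space set \<Rightarrow> ('a \<Rightarrow> 'a) \<Rightarrow> 'a set set \<Rightarrow> bool" where
  "strong_Markov_partition X T \<M> \<longleftrightarrow>
     finite \<M> \<and> \<Union>\<M> = X \<and>
     (\<forall>A\<in>\<M>. connected A \<and> top_of_set X interior_of A \<noteq> {} \<and>
              finite (top_of_set X frontier_of A)) \<and>
     (\<forall>A\<in>\<M>. \<forall>B\<in>\<M>. A \<noteq> B \<longrightarrow>
        top_of_set X interior_of A \<inter> top_of_set X interior_of B = {}) \<and>
     (\<forall>A\<in>\<M>. \<exists>\<N>\<subseteq>\<M>. T ` A = \<Union>\<N>) \<and>
     (\<forall>A\<in>\<M>. \<exists>g. homeomorphism A (T ` A) T g)"

section \<open>Components of transitivity\<close>

definition leads_to ::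
  "'a::topological_space set \<Rightarrow> ('a \<Rightarrow> 'a) \<Rightarrow> 'a set set \<Rightarrow> 'a set \<Rightarrow> 'a set \<Rightarrow> bool" where
  "leads_to X T \<M> A B \<longleftrightarrow> A \<in> \<M> \<and> B \<in> \<M> \<and>
     (\<exists>n>0. top_of_set X interior_of ((T ^^ n) ` A \<inter> B) \<noteq> {})"

text \<open>
  \<open>leads_to\<close> is in general neither reflexive nor symmetric; belonging to the same
  component is the equivalence relation it generates. As the image of an element
  is a union of elements, every component is mapped into itself by \<open>T\<close>.
\<close>

definition transitivity_components ::
  "'a::topological_space set \<Rightarrow> ('a \<Rightarrow> 'a) \<Rightarrow> 'a set set \<Rightarrow> 'a set set set" where
  "transitivity_components X T \<M> = {{B \<in> \<M>. equivclp (leads_to X T \<M>) A B} | A. A \<in> \<M>}"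

text \<open>
  The invariant measure lives on the component; it is finite and not zero, so
  it can be normalised to a probability measure. Measurability of \<open>T\<close> from \<open>\<mu>\<close> to \<open>\<mu>\<close> includes
  that \<open>T\<close> maps the component into itself.
\<close>

definition strongly_chaotic ::
  "'a::topological_space measure \<Rightarrow> ('a \<Rightarrow> 'a) \<Rightarrow> 'a set set \<Rightarrow> bool" where
  "strongly_chaotic \<Lambda> T K \<longleftrightarrow>
     (\<exists>\<mu>. finite_measure \<mu> \<and> emeasure \<mu> (space \<mu>) \<noteq> 0 \<and>
          sets \<mu> = sets (restrict_space borel (\<Union>K)) \<and>
          absolutely_continuous (restrict_space \<Lambda> (\<Union>K)) \<mu> \<and>
          T \<in> measurable \<mu> \<mu> \<and> distr \<mu> \<mu> T = \<mu>)"

definition neutral :: "('a \<Rightarrow> 'a) \<Rightarrow> 'a set set \<Rightarrow> bool" where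
  "neutral T K \<longleftrightarrow> (\<forall>x\<in>\<Union>K. \<exists>m p. 0 < p \<and> (T ^^ (m + p)) x = (T ^^ m) x)"

end

theory Submission
  imports Defs
begin

text \<open>
  In a convex polygon every map \<open>\<tau>\<close> of the boundary for which no side contains both \<open>x\<close> and \<open>\<tau> x\<close>
  is the first return map of the field \<open>v x = \<tau> x - x\<close>. On the square \<open>[-1, 1]\<^sup>2\<close> we take
  \<open>\<tau> (x, y) = (x, -y)\<close> on the open horizontal sides, which is an involution, and
  \<open>\<tau> (x, y) = (-x, f y)\<close> on the closed vertical sides, where \<open>f\<close> is piecewise linear with three
  full branches of slopes \<open>-3, 3, -3\<close> and therefore preserves Lebesgue measure. Two branches would
  not do: the corners \<open>(1, \<plusminus>1)\<close> have to leave the horizontal sides, which forces \<open>f (\<plusminus>1) = \<mp>1\<close>.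
\<close>

section \<open>Points and segments of the plane in coordinates\<close>

lemma vec2_eq_iff: "(x :: real^2) = y \<longleftrightarrow> x $ 1 = y $ 1 \<and> x $ 2 = y $ 2"
  by (simp add: vec_eq_iff forall_2)

definition pt :: "real \<Rightarrow> real \<Rightarrow> real^2" where
  "pt a b = vector [a, b]"

lemma pt_nth [simp]: "pt a b $ 1 = a" "pt a b $ 2 = b"
  by (simp_all add: pt_def)

lemma pt_eq_iff [simp]: "pt a b = pt c d \<longleftrightarrow> a = c \<and> b = d"
  by (simp add: vec2_eq_iff)

lemma continuous_on_pt [continuous_intros]:
  assumes "continuous_on S f" "continuous_on S g"
  shows "continuous_on S (\<lambda>x. pt (f x) (g x))"
proof -
  have "continuous_on S (\<lambda>x. \<chi> i. pt (f x) (g x) $ i)"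
  proof (rule continuous_on_vec_lambda)
    fix i :: 2
    show "continuous_on S (\<lambda>x. pt (f x) (g x) $ i)"
      using exhaust_2[of i] assms by auto
  qed
  then show ?thesis by simp
qed

lemma linepath_pt: "linepath (pt a b) (pt c d) t = pt (a + t * (c - a)) (b + t * (d - b))"
  by (simp add: vec2_eq_iff linepath_def algebra_simps)

lemma closed_segment_horizontal:
  "closed_segment (pt (-1) b) (pt 1 b) = {x. \<bar>x $ 1\<bar> \<le> 1 \<and> x $ 2 = b}" (is "?L = ?R")
proof
  show "?L \<subseteq> ?R" unfolding closed_segment_def by auto (simp_all add: algebra_simps)
  show "?R \<subseteq> ?L"
  proof
    fix x assume x: "x \<in> ?R"
    then have "x = (1 - (x $ 1 + 1) / 2) *\<^sub>R pt (-1) b + ((x $ 1 + 1) / 2) *\<^sub>R pt 1 b"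
      by (simp add: vec2_eq_iff field_simps)
    moreover have "0 \<le> (x $ 1 + 1) / 2" "(x $ 1 + 1) / 2 \<le> 1" using x by auto
    ultimately show "x \<in> ?L" unfolding closed_segment_def by blast
  qed
qed

lemma closed_segment_vertical:
  "closed_segment (pt a (-1)) (pt a 1) = {x. x $ 1 = a \<and> \<bar>x $ 2\<bar> \<le> 1}" (is "?L = ?R")
proof
  show "?L \<subseteq> ?R" unfolding closed_segment_def by auto (simp_all add: algebra_simps)
  show "?R \<subseteq> ?L"
  proof
    fix x assume x: "x \<in> ?R"
    then have "x = (1 - (x $ 2 + 1) / 2) *\<^sub>R pt a (-1) + ((x $ 2 + 1) / 2) *\<^sub>R pt a 1"
      by (simp add: vec2_eq_iff field_simps)
    moreover have "0 \<le> (x $ 2 + 1) / 2" "(x $ 2 + 1) / 2 \<le> 1" using x by auto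
    ultimately show "x \<in> ?L" unfolding closed_segment_def by blast
  qed
qed

section \<open>The square\<close>

text \<open>Counterclockwise from the lower left corner: sides 0 and 2 are horizontal, side 1 runs
  upward and side 3 downward. These opposite orientations reappear in
  \<open>unit_zigzag\<close>.\<close>

definition square :: "(real^2) list" where
  "square = [pt (-1) (-1), pt 1 (-1), pt 1 1, pt (-1) 1]"

definition square_boundary :: "(real^2) set" where
  "square_boundary = {x. \<bar>x $ 1\<bar> \<le> 1 \<and> \<bar>x $ 2\<bar> \<le> 1 \<and> (\<bar>x $ 1\<bar> = 1 \<or> \<bar>x $ 2\<bar> = 1)}"

lemma length_square [simp]: "length square = 4"
  by (simp add: square_def)

lemma all_less_4: "(\<forall>i<4. P i) \<longleftrightarrow> P 0 \<and> P (Suc 0) \<and> P 2 \<and> P (3::nat)"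
  by (simp add: numeral_eq_Suc All_less_Suc2)

lemma square_nth [simp]:
  "square ! 0 = pt (-1) (-1)" "square ! Suc 0 = pt 1 (-1)" "square ! 2 = pt 1 1"
  "square ! 3 = pt (-1) 1"
  by (simp_all add: square_def numeral_eq_Suc)

lemma side_square:
  "side square 0 = {x. \<bar>x $ 1\<bar> \<le> 1 \<and> x $ 2 = -1}"
  "side square (Suc 0) = {x. x $ 1 = 1 \<and> \<bar>x $ 2\<bar> \<le> 1}"
  "side square 2 = {x. \<bar>x $ 1\<bar> \<le> 1 \<and> x $ 2 = 1}"
  "side square 3 = {x. x $ 1 = -1 \<and> \<bar>x $ 2\<bar> \<le> 1}"
  unfolding side_def length_square closed_segment_horizontal[symmetric]
    closed_segment_vertical[symmetric]
  by (simp_all add: closed_segment_commute numeral_2_eq_2[symmetric] numeral_3_eq_3[symmetric])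

lemma lessThan_4: "{..<4::nat} = {0, 1, 2, 3}"
  by auto

lemma sides_union_square: "sides_union square = square_boundary"
  unfolding sides_union_def length_square lessThan_4 square_boundary_def
  by (auto simp: side_square)

lemma simple_polygon_square: "simple_polygon square"
proof -
  have "distinct square" by (simp add: square_def)
  moreover have "\<forall>i<4. \<forall>j<4. i \<noteq> j \<longrightarrow>
        side square i \<inter> side square j =
          {square ! i, square ! (Suc i mod 4)} \<inter> {square ! j, square ! (Suc j mod 4)}"
    unfolding all_less_4 side_square
    by (auto simp: vec2_eq_iff numeral_2_eq_2[symmetric] numeral_3_eq_3[symmetric])
  ultimately show ?thesis by (simp add: simple_polygon_def)
qed

definition open_square :: "(real^2) set" where
  "open_square = box (pt (-1) (-1)) (pt 1 1)"

lemma mem_open_square: "x \<in> open_square \<longleftrightarrow> \<bar>x $ 1\<bar> < 1 \<and> \<bar>x $ 2\<bar> < 1"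
  by (auto simp: open_square_def mem_box_cart forall_2)

lemma open_square_nonempty: "open_square \<noteq> {}"
  using mem_open_square[of 0] by auto

lemma frontier_open_square: "frontier open_square = square_boundary"
proof -
  have "frontier open_square = cbox (pt (-1) (-1)) (pt 1 1) - open_square"
    using open_square_nonempty unfolding open_square_def by (simp only: frontier_box if_False)
  moreover have "x \<in> cbox (pt (-1) (-1)) (pt 1 1) \<longleftrightarrow> \<bar>x $ 1\<bar> \<le> 1 \<and> \<bar>x $ 2\<bar> \<le> 1" for x
    by (simp add: mem_box_cart forall_2 abs_le_iff) argo
  ultimately show ?thesis
    unfolding set_eq_iff Diff_iff mem_open_square square_boundary_def mem_Collect_eq less_le by blast
qed

text \<open>The curve is the frontier of an open box, and for a bounded convex set the inside of the
  frontier is the interior.\<close>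

lemma polygon_region_square: "polygon_region square = open_square"
proof -
  have "inside (frontier open_square) = interior open_square"
    by (rule inside_frontier_eq_interior) (simp_all add: open_square_def bounded_box convex_box)
  then show ?thesis
    by (simp add: polygon_region_def sides_union_square frontier_open_square)
       (simp add: open_square_def interior_open open_box)
qed

section \<open>The boundary map\<close>

text \<open>The map \<open>f\<close> of the idea above. The difference of the absolute values is -2,
  \<open>6 * y\<close> and 2 on the three thirds of \<open>[-1, 1]\<close>, which gives the branches
  \<open>-2 - 3 * y\<close>, \<open>3 * y\<close> and \<open>2 - 3 * y\<close>.\<close>

definition zigzag :: "real \<Rightarrow> real" where
  "zigzag y = \<bar>3 * y + 1\<bar> - \<bar>3 * y - 1\<bar> - 3 * y"

lemma zigzag_uminus: "zigzag (- y) = - zigzag y"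
  by (simp add: zigzag_def abs_if)

lemma abs_zigzag_le: "\<bar>y\<bar> \<le> 1 \<Longrightarrow> \<bar>zigzag y\<bar> \<le> 1"
  by (simp add: zigzag_def abs_if split: if_splits)

text \<open>The end points 1 and -1 are exchanged, so a point and its image are never both 1 or both
  -1. This keeps chords between the vertical sides from running along a horizontal side.\<close>

lemma zigzag_less: "\<bar>y\<bar> \<le> 1 \<Longrightarrow> \<bar>y + zigzag y\<bar> < 2"
  by (simp add: zigzag_def abs_if split: if_splits)

text \<open>Testing the first coordinate assigns the corners to the vertical sides.\<close>

definition bounce :: "real^2 \<Rightarrow> real^2" where
  "bounce x = (if \<bar>x $ 1\<bar> = 1 then pt (- x $ 1) (zigzag (x $ 2)) else pt (x $ 1) (- x $ 2))"

definition bounce_field :: "real^2 \<Rightarrow> real^2" where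
  "bounce_field x = bounce x - x"

lemma bounce_in_boundary: "x \<in> square_boundary \<Longrightarrow> bounce x \<in> square_boundary"
  by (auto simp: square_boundary_def bounce_def abs_zigzag_le)

text \<open>An open chord could meet the boundary only if one coordinate were 1 at both ends or -1
  at both ends, and \<open>bounce\<close> never joins two points of one side.\<close>

lemma chord_in_open_square:
  assumes x: "x \<in> square_boundary" and t: "0 < t" "t < 1"
  shows "x + t *\<^sub>R bounce_field x \<in> open_square"
proof -
  \<comment> \<open>\<open>\<bar>a + b\<bar> < 2\<close> rules out \<open>a = b = 1\<close> and
    \<open>a = b = -1\<close>. Both weights \<open>1 - t\<close> and \<open>t\<close> are positive,
    so one end value off the bound already makes the inequality strict.\<close>
  have conv: "\<bar>a + t * (b - a)\<bar> < 1" if "\<bar>a\<bar> \<le> 1" "\<bar>b\<bar> \<le> 1" "\<bar>a + b\<bar> < 2" for a b :: real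
  proof -
    have eq: "a + t * (b - a) = (1 - t) * a + t * b" by (simp add: algebra_simps)
    have "(1 - t) * a + t * b < 1"
    proof (cases "a < 1")
      case True
      then have "(1 - t) * a < (1 - t) * 1" using t by (intro mult_strict_left_mono) auto
      moreover have "t * b \<le> t * 1" using t that by (intro mult_left_mono) auto
      ultimately show ?thesis by simp
    next
      case False
      then have "b < 1" using that by auto
      then have "t * b < t * 1" using t by (intro mult_strict_left_mono) auto
      moreover have "(1 - t) * a \<le> (1 - t) * 1" using t that by (intro mult_left_mono) auto
      ultimately show ?thesis by simp
    qed
    moreover have "(1 - t) * a + t * b > -1"
    proof (cases "a > -1")
      case True
      then have "(1 - t) * a > (1 - t) * (-1)" using t by (intro mult_strict_left_mono) auto
      moreover have "t * b \<ge> t * (-1)" using t that by (intro mult_left_mono) auto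
      ultimately show ?thesis by simp
    next
      case False
      then have "b > -1" using that by auto
      then have "t * b > t * (-1)" using t by (intro mult_strict_left_mono) auto
      moreover have "(1 - t) * a \<ge> (1 - t) * (-1)" using t that by (intro mult_left_mono) auto
      ultimately show ?thesis by simp
    qed
    ultimately show ?thesis unfolding eq by simp
  qed
  have le: "\<bar>x $ 1\<bar> \<le> 1" "\<bar>x $ 2\<bar> \<le> 1" "\<bar>bounce x $ 1\<bar> \<le> 1" "\<bar>bounce x $ 2\<bar> \<le> 1"
    using x bounce_in_boundary[OF x] by (auto simp: square_boundary_def)
  \<comment> \<open>In each case one of the sums is 0. The other is \<open>2 * x $ 1\<close> with
    \<open>\<bar>x $ 1\<bar> < 1\<close> on an open horizontal side, and falls under
    \<open>zigzag_less\<close> on a vertical side.\<close>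
  have "\<bar>x $ 1 + bounce x $ 1\<bar> < 2" "\<bar>x $ 2 + bounce x $ 2\<bar> < 2"
    using le(1,2) by (auto simp: bounce_def zigzag_less)
  with le show ?thesis
    by (simp add: mem_open_square bounce_field_def conv)
qed

lemma pseudo_billiard_square: "pseudo_billiard (polygon_region square) bounce_field"
  unfolding pseudo_billiard_def polygon_region_square frontier_open_square
proof (intro conjI ballI)
  show "open open_square" "connected open_square"
    by (simp_all add: open_square_def open_box convex_connected convex_box)
  show "open_square \<noteq> {}" by (rule open_square_nonempty)
  fix x assume "x \<in> square_boundary"
  then show "\<forall>\<^sub>F t in at_right 0. x + t *\<^sub>R bounce_field x \<in> open_square"
    unfolding eventually_at_right_field by (intro exI[of _ 1]) (auto intro: chord_in_open_square)
qed

section \<open>The first return map and its discontinuity\<close>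

definition return_map :: "real^2 \<Rightarrow> real^2" where
  "return_map = first_return square_boundary bounce_field"

text \<open>The field is scaled so that each flight lasts exactly time 1: earlier the particle is in
  the open square, and at time 1 it is at \<open>bounce x\<close>.\<close>

lemma return_map_eq:
  assumes x: "x \<in> square_boundary"
  shows "return_map x = bounce x"
proof -
  have disj: "open_square \<inter> square_boundary = {}"
    by (auto simp: mem_open_square square_boundary_def)
  have "Inf {t. 0 < t \<and> x + t *\<^sub>R bounce_field x \<in> square_boundary} = 1"
  proof (rule cInf_eq_minimum)
    show "1 \<in> {t. 0 < t \<and> x + t *\<^sub>R bounce_field x \<in> square_boundary}"
      using bounce_in_boundary[OF x] by (simp add: bounce_field_def)
    fix t assume "t \<in> {t. 0 < t \<and> x + t *\<^sub>R bounce_field x \<in> square_boundary}"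
    then show "1 \<le> t" using chord_in_open_square[OF x, of t] disj by force
  qed
  then show ?thesis
    by (simp add: return_map_def first_return_def return_time_def bounce_field_def)
qed

text \<open>Along the top side towards the corner \<open>pt 1 1\<close> the images keep a first
  coordinate close to 1, whereas the corner itself is sent to the opposite vertical side.\<close>

lemma not_continuous_return_map: "\<not> continuous_on square_boundary return_map"
proof
  assume "continuous_on square_boundary return_map"
  then have cont: "continuous_on square_boundary bounce"
    by (rule continuous_on_eq) (rule return_map_eq)
  define X where "X n = pt (1 - inverse (real (Suc n))) 1" for n
  have "inverse (real (Suc n)) \<le> 1" for n by (simp add: divide_simps)
  then have mem: "X n \<in> square_boundary" for n
    by (simp add: X_def square_boundary_def)
  have lim: "(\<lambda>n. 1 - inverse (real (Suc n))) \<longlonglongrightarrow> 1"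
    using tendsto_diff[OF tendsto_const LIMSEQ_inverse_real_of_nat, of 1] by simp
  have "X \<longlonglongrightarrow> pt 1 1"
    unfolding X_def
  proof (rule vec_tendstoI)
    fix i :: 2
    show "(\<lambda>n. pt (1 - inverse (real (Suc n))) 1 $ i) \<longlonglongrightarrow> pt 1 1 $ i"
      using exhaust_2[of i] lim by auto
  qed
  moreover have "pt 1 1 \<in> square_boundary" by (simp add: square_boundary_def)
  ultimately have "(\<lambda>n. bounce (X n)) \<longlonglongrightarrow> bounce (pt 1 1)"
    using cont mem unfolding continuous_on_sequentially by (auto simp: o_def)
  then have "(\<lambda>n. bounce (X n) $ 1) \<longlonglongrightarrow> bounce (pt 1 1) $ 1"
    by (rule tendsto_vec_nth)
  moreover have "bounce (X n) $ 1 = 1 - inverse (real (Suc n))" for n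
    using \<open>inverse (real (Suc n)) \<le> 1\<close> by (simp add: bounce_def X_def)
  ultimately have "(\<lambda>n. 1 - inverse (real (Suc n))) \<longlonglongrightarrow> -1"
    by (simp add: bounce_def)
  with lim have "(1::real) = -1" by (rule LIMSEQ_unique)
  then show False by simp
qed

section \<open>The Markov partition\<close>

text \<open>The index \<open>k\<close> numbers the laps of \<open>zigzag\<close>; the third is
  centred at height \<open>2 * k / 3\<close>. Neighbouring thirds share an end point at height 1/3
  or -1/3.\<close>

definition vertical_third :: "real \<Rightarrow> real \<Rightarrow> (real^2) set" where
  "vertical_third s k = {x. x $ 1 = s \<and> \<bar>x $ 2 - 2 * k / 3\<bar> \<le> 1 / 3}"

text \<open>The end points are left out because the corners lie in vertical elements.\<close>

definition horizontal_side :: "real \<Rightarrow> (real^2) set" where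
  "horizontal_side s = {x. \<bar>x $ 1\<bar> < 1 \<and> x $ 2 = s}"

definition vertical_elements :: "(real^2) set set" where
  "vertical_elements = {vertical_third s k | s k. s \<in> {-1, 1} \<and> k \<in> {-1, 0, 1}}"

definition horizontal_elements :: "(real^2) set set" where
  "horizontal_elements = {horizontal_side s | s. s \<in> {-1, 1}}"

lemma vertical_elementsI:
  "s \<in> {-1, 1} \<Longrightarrow> k \<in> {-1, 0, 1} \<Longrightarrow> vertical_third s k \<in> vertical_elements"
  unfolding vertical_elements_def by blast

lemma horizontal_elementsI: "s \<in> {-1, 1} \<Longrightarrow> horizontal_side s \<in> horizontal_elements"
  unfolding horizontal_elements_def by blast

lemma vertical_thirds_cover:
  "\<Union> {vertical_third s k | k. k \<in> {-1, 0, 1}} = {x. x $ 1 = s \<and> \<bar>x $ 2\<bar> \<le> 1}"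
proof (intro equalityI subsetI)
  fix x :: "real^2" assume x: "x \<in> {x. x $ 1 = s \<and> \<bar>x $ 2\<bar> \<le> 1}"
  consider "x $ 2 \<le> -1/3" | "\<bar>x $ 2\<bar> \<le> 1/3" | "x $ 2 \<ge> 1/3" by linarith
  then show "x \<in> \<Union> {vertical_third s k | k. k \<in> {-1, 0, 1}}"
  proof cases
    case 1
    then have "x \<in> vertical_third s (-1)" using x by (auto simp: vertical_third_def abs_if)
    then show ?thesis by blast
  next
    case 2
    then have "x \<in> vertical_third s 0" using x by (auto simp: vertical_third_def)
    then show ?thesis by blast
  next
    case 3
    then have "x \<in> vertical_third s 1" using x by (auto simp: vertical_third_def abs_if)
    then show ?thesis by blast
  qed
qed (auto simp: vertical_third_def abs_if split: if_splits)

lemma Union_vertical_elements: "\<Union> vertical_elements = {x. \<bar>x $ 1\<bar> = 1 \<and> \<bar>x $ 2\<bar> \<le> 1}"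
proof -
  have "\<Union> vertical_elements = (\<Union>s\<in>{-1, 1}. \<Union> {vertical_third s k | k. k \<in> {-1, 0, 1}})"
    unfolding vertical_elements_def by blast
  then show ?thesis unfolding vertical_thirds_cover by auto
qed

lemma Union_horizontal_elements: "\<Union> horizontal_elements = {x. \<bar>x $ 1\<bar> < 1 \<and> \<bar>x $ 2\<bar> = 1}"
proof -
  have "\<Union> horizontal_elements = horizontal_side 1 \<union> horizontal_side (-1)"
    by (auto simp: horizontal_elements_def)
  then show ?thesis by (auto simp: horizontal_side_def)
qed

lemma Union_elements: "\<Union> (vertical_elements \<union> horizontal_elements) = square_boundary"
  unfolding Union_Un_distrib Union_vertical_elements Union_horizontal_elements
  by (auto simp: square_boundary_def)

lemma elements_disjoint: "\<Union> vertical_elements \<inter> \<Union> horizontal_elements = {}"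
  unfolding Union_vertical_elements Union_horizontal_elements by auto

section \<open>Interiors and frontiers relative to the boundary\<close>

text \<open>A connected set with more than one point has no isolated points, so its nonempty
  relatively open subsets are infinite. This turns finite overlaps of elements into disjoint
  interiors.\<close>

lemma square_boundary_interior_finite:
  assumes "finite F"
  shows "top_of_set square_boundary interior_of F = {}"
proof (rule ccontr)
  assume "top_of_set square_boundary interior_of F \<noteq> {}"
  then obtain x U where U: "open U" "x \<in> U" "x \<in> square_boundary" "square_boundary \<inter> U \<subseteq> F"
    unfolding interior_of_def openin_open by blast
  \<comment> \<open>Connectedness comes from running through the four sides in one path.\<close>
  have "square_boundary = path_image (linepath (pt (-1) (-1)) (pt 1 (-1)) +++
      linepath (pt 1 (-1)) (pt 1 1) +++ linepath (pt 1 1) (pt (-1) 1) +++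
      linepath (pt (-1) 1) (pt (-1) (-1)))"
    unfolding sides_union_square[symmetric] sides_union_def length_square lessThan_4
    by (auto simp: path_image_join side_def numeral_2_eq_2[symmetric] numeral_3_eq_3[symmetric])
  then have "connected square_boundary"
    using connected_path_image by (metis path_join path_linepath pathstart_join
        pathstart_linepath pathfinish_linepath)
  moreover have "pt 1 1 \<in> square_boundary" "pt 1 0 \<in> square_boundary" "pt 1 1 \<noteq> pt 1 0"
    by (auto simp: square_boundary_def)
  ultimately have "x islimpt square_boundary"
    using connected_imp_perfect U(3) by (metis is_singletonE is_singletonI' singletonD)
  then have "infinite (square_boundary \<inter> U)"
    using U by (auto simp: islimpt_eq_acc_point Int_commute)
  then show False using U(4) assms finite_subset by blast
qed

text \<open>The open set bounds the interior of \<open>A\<close> from below and the closed set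
  bounds its closure from above, so the frontier is caught in the finite set
  \<open>C - U\<close>.\<close>

lemma element_topology:
  assumes "open U" "closed C" "square_boundary \<inter> U \<subseteq> A" "A \<subseteq> C" "A \<subseteq> square_boundary"
    and "finite (C - U)" "square_boundary \<inter> U \<noteq> {}"
  shows "top_of_set square_boundary interior_of A \<noteq> {}"
    and "finite (top_of_set square_boundary frontier_of A)"
proof -
  have int: "square_boundary \<inter> U \<subseteq> top_of_set square_boundary interior_of A"
    using assms by (intro interior_of_maximal) auto
  then show "top_of_set square_boundary interior_of A \<noteq> {}" using assms(7) by blast
  have "top_of_set square_boundary closure_of A \<subseteq> square_boundary \<inter> C"
    using assms by (intro closure_of_minimal) (auto simp: closedin_closed)
  then have "top_of_set square_boundary frontier_of A \<subseteq> C - U"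
    using int unfolding frontier_of_def by blast
  then show "finite (top_of_set square_boundary frontier_of A)"
    using assms(6) finite_subset by blast
qed

lemma vertical_third_topology:
  assumes "s \<in> {-1, 1}" "k \<in> {-1, 0, 1}"
  shows "top_of_set square_boundary interior_of vertical_third s k \<noteq> {}"
    and "finite (top_of_set square_boundary frontier_of vertical_third s k)"
proof -
  \<comment> \<open>The sign condition selects the half plane of the side \<open>x $ 1 = s\<close>;
    the strict band drops the two ends of the third.\<close>
  let ?U = "{x :: real^2. 0 < s * x $ 1 \<and> \<bar>x $ 2 - 2 * k / 3\<bar> < 1 / 3}"
  have "open ?U"
    by (intro open_Collect_conj open_Collect_less continuous_intros)
  moreover have "closed (vertical_third s k)"
    unfolding vertical_third_def
    by (intro closed_Collect_conj closed_Collect_le closed_Collect_eq continuous_intros)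
  moreover have "square_boundary \<inter> ?U \<subseteq> vertical_third s k"
  proof
    fix x assume "x \<in> square_boundary \<inter> ?U"
    then have x: "\<bar>x $ 1\<bar> = 1 \<or> \<bar>x $ 2\<bar> = 1" "0 < s * x $ 1" "\<bar>x $ 2 - 2 * k / 3\<bar> < 1 / 3"
      by (simp_all add: square_boundary_def)
    \<comment> \<open>The band therefore stays strictly between the heights -1 and 1, where only
      vertical sides are met.\<close>
    have "\<bar>2 * k / 3\<bar> \<le> 2 / 3" using assms(2) by auto
    with x(3) have "\<bar>x $ 2\<bar> < 1" by linarith
    with x(1) have "\<bar>x $ 1\<bar> = 1" by simp
    then have "x $ 1 = s" using x(2) assms(1) by auto
    with x(3) show "x \<in> vertical_third s k" by (simp add: vertical_third_def)
  qed
  moreover have "vertical_third s k \<subseteq> square_boundary"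
    using Union_elements vertical_elementsI[OF assms] by blast
  moreover have "vertical_third s k - ?U \<subseteq> {pt s (2 * k / 3 - 1 / 3), pt s (2 * k / 3 + 1 / 3)}"
  proof
    fix x assume "x \<in> vertical_third s k - ?U"
    moreover have "0 < s * s" using assms(1) by auto
    ultimately have "x $ 1 = s" "\<bar>x $ 2 - 2 * k / 3\<bar> = 1 / 3"
      by (auto simp: vertical_third_def)
    then show "x \<in> {pt s (2 * k / 3 - 1 / 3), pt s (2 * k / 3 + 1 / 3)}"
      by (auto simp: vec2_eq_iff abs_if split: if_splits)
  qed
  then have "finite (vertical_third s k - ?U)" by (rule finite_subset) simp
  moreover have "pt s (2 * k / 3) \<in> square_boundary \<inter> ?U"
    using assms by (auto simp: square_boundary_def)
  then have "square_boundary \<inter> ?U \<noteq> {}" by blast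
  ultimately show "top_of_set square_boundary interior_of vertical_third s k \<noteq> {}"
    and "finite (top_of_set square_boundary frontier_of vertical_third s k)"
    using element_topology[of ?U "vertical_third s k" "vertical_third s k"] by blast+
qed

lemma horizontal_side_topology:
  assumes "s \<in> {-1, 1}"
  shows "top_of_set square_boundary interior_of horizontal_side s \<noteq> {}"
    and "finite (top_of_set square_boundary frontier_of horizontal_side s)"
proof -
  let ?U = "{x :: real^2. 0 < s * x $ 2 \<and> \<bar>x $ 1\<bar> < 1}"
  \<comment> \<open>The element is not closed, so its closure is bounded by the side with both
    corners.\<close>
  let ?C = "{x :: real^2. x $ 2 = s \<and> \<bar>x $ 1\<bar> \<le> 1}"
  have "open ?U"
    by (intro open_Collect_conj open_Collect_less continuous_intros)
  moreover have "closed ?C"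
    by (intro closed_Collect_conj closed_Collect_le closed_Collect_eq continuous_intros)
  moreover have "square_boundary \<inter> ?U \<subseteq> horizontal_side s"
    using assms by (auto simp: square_boundary_def horizontal_side_def)
  moreover have "horizontal_side s \<subseteq> square_boundary"
    using Union_elements horizontal_elementsI[OF assms] by blast
  moreover have "horizontal_side s \<subseteq> ?C"
    by (auto simp: horizontal_side_def)
  moreover have "?C - ?U \<subseteq> {pt (-1) s, pt 1 s}"
    using assms by (auto simp: vec2_eq_iff)
  then have "finite (?C - ?U)" by (rule finite_subset) simp
  moreover have "pt 0 s \<in> square_boundary \<inter> ?U"
    using assms by (auto simp: square_boundary_def)
  then have "square_boundary \<inter> ?U \<noteq> {}" by blast
  ultimately show "top_of_set square_boundary interior_of horizontal_side s \<noteq> {}"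
    and "finite (top_of_set square_boundary frontier_of horizontal_side s)"
    using element_topology[of ?U ?C "horizontal_side s"] by blast+
qed

section \<open>Branches and images of the return map\<close>

lemma zigzag_branch:
  assumes "k \<in> {-1, 0, 1}" "\<bar>y - 2 * k / 3\<bar> \<le> 1 / 3"
  shows "zigzag y = 2 * k + (if k = 0 then 3 else -3) * y"
  using assms by (auto simp: zigzag_def abs_if split: if_splits)

lemma vertical_third_subset: "s \<in> {-1, 1} \<Longrightarrow> k \<in> {-1, 0, 1} \<Longrightarrow> vertical_third s k \<subseteq> square_boundary"
  using Union_elements vertical_elementsI by blast

lemma horizontal_side_subset: "s \<in> {-1, 1} \<Longrightarrow> horizontal_side s \<subseteq> square_boundary"
  using Union_elements horizontal_elementsI by blast

lemma return_map_vertical_third: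
  assumes "s \<in> {-1, 1}" "k \<in> {-1, 0, 1}" "x \<in> vertical_third s k"
  shows "return_map x = pt (-1 * x $ 1) (2 * k + (if k = 0 then 3 else -3) * x $ 2)"
proof -
  have "x \<in> square_boundary" using vertical_third_subset assms by blast
  moreover have "x $ 1 = s" "\<bar>x $ 2 - 2 * k / 3\<bar> \<le> 1 / 3"
    using assms(3) by (simp_all add: vertical_third_def)
  ultimately show ?thesis
    using assms(1) zigzag_branch[OF assms(2)] by (auto simp: return_map_eq bounce_def)
qed

text \<open>The factor 1 and the summand 0 give the diagonal affine shape that
  \<open>homeomorphism_diagonal_affine\<close> expects.\<close>

lemma return_map_horizontal_side:
  assumes "s \<in> {-1, 1}" "x \<in> horizontal_side s"
  shows "return_map x = pt (1 * x $ 1) (0 + (-1) * x $ 2)"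
proof -
  have "x \<in> square_boundary" using horizontal_side_subset assms by blast
  then show ?thesis
    using assms(2) by (auto simp: return_map_eq bounce_def horizontal_side_def)
qed

lemma homeomorphism_diagonal_affine:
  fixes T :: "real^2 \<Rightarrow> real^2"
  assumes "a \<noteq> 0" "c \<noteq> 0" and T: "\<And>x. x \<in> A \<Longrightarrow> T x = pt (a * x $ 1) (b + c * x $ 2)"
  shows "\<exists>g. homeomorphism A (T ` A) T g"
proof
  let ?g = "\<lambda>y. pt (y $ 1 / a) ((y $ 2 - b) / c)"
  have inv: "?g (T x) = x" if "x \<in> A" for x
    using assms(1,2) T[OF that] by (simp add: vec2_eq_iff)
  have "continuous_on A (\<lambda>x. pt (a * x $ 1) (b + c * x $ 2))"
    by (intro continuous_intros)
  then have "continuous_on A T"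
    using T by (simp cong: continuous_on_cong)
  moreover have "continuous_on (T ` A) ?g"
    using assms(1,2) by (intro continuous_intros) auto
  ultimately show "homeomorphism A (T ` A) T ?g"
    using inv by (auto simp: homeomorphism_def image_image cong: image_cong)
qed

text \<open>Every branch is full: slope 3 or -3 stretches a segment of length 2/3 onto the whole
  opposite side.\<close>

lemma return_map_image_vertical_third:
  assumes s: "s \<in> {-1, 1}" and k: "k \<in> {-1, 0, 1}"
  shows "return_map ` vertical_third s k = {x. x $ 1 = - s \<and> \<bar>x $ 2\<bar> \<le> 1}" (is "_ = ?R")
proof
  show "return_map ` vertical_third s k \<subseteq> ?R"
    using k by (auto simp: return_map_vertical_third[OF s k] vertical_third_def abs_if
        split: if_splits)
  show "?R \<subseteq> return_map ` vertical_third s k"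
  proof
    fix y assume y: "y \<in> ?R"
    \<comment> \<open>The second coordinate solves the affine equation of the branch
      \<open>k\<close>.\<close>
    let ?x = "pt s ((y $ 2 - 2 * k) / (if k = 0 then 3 else -3))"
    have x: "?x \<in> vertical_third s k"
      using y k by (auto simp: vertical_third_def abs_if field_simps split: if_splits)
    moreover have "return_map ?x = y"
      using y by (simp add: return_map_vertical_third[OF s k x] vec2_eq_iff)
    ultimately show "y \<in> return_map ` vertical_third s k" by force
  qed
qed

lemma return_map_image_horizontal_side:
  assumes s: "s \<in> {-1, 1}"
  shows "return_map ` horizontal_side s = horizontal_side (- s)"
proof
  show "return_map ` horizontal_side s \<subseteq> horizontal_side (- s)"
    by (auto simp: return_map_horizontal_side[OF s]) (auto simp: horizontal_side_def)
  show "horizontal_side (- s) \<subseteq> return_map ` horizontal_side s"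
  proof
    fix y assume y: "y \<in> horizontal_side (- s)"
    let ?x = "pt (y $ 1) (- y $ 2)"
    have x: "?x \<in> horizontal_side s" using y by (auto simp: horizontal_side_def)
    moreover have "return_map ?x = y"
      by (simp add: return_map_horizontal_side[OF s x] vec2_eq_iff)
    ultimately show "y \<in> return_map ` horizontal_side s" by force
  qed
qed

section \<open>Verification of the Markov partition\<close>

lemma thirds_overlap:
  fixes y :: real
  assumes "k \<in> {-1, 0, 1}" "k' \<in> {-1, 0, 1}" "k \<noteq> k'"
    "\<bar>y - 2 * k / 3\<bar> \<le> 1 / 3" "\<bar>y - 2 * k' / 3\<bar> \<le> 1 / 3"
  shows "y = 1 / 3 \<or> y = -1 / 3"
proof -
  have "y \<le> 2 * k / 3 + 1 / 3" "y \<ge> 2 * k / 3 - 1 / 3"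
    "y \<le> 2 * k' / 3 + 1 / 3" "y \<ge> 2 * k' / 3 - 1 / 3"
    using assms(4,5) by linarith+
  then show ?thesis using assms(1-3) by auto
qed

text \<open>Distinct elements can meet only as thirds of one vertical side, and then at height 1/3
  or -1/3.\<close>

lemma elements_overlap_finite:
  assumes "A \<in> vertical_elements \<union> horizontal_elements"
    "B \<in> vertical_elements \<union> horizontal_elements" "A \<noteq> B"
  shows "finite (A \<inter> B)"
proof -
  consider "A \<in> vertical_elements" "B \<in> vertical_elements"
    | "A \<in> horizontal_elements" "B \<in> horizontal_elements" | "A \<inter> B = {}"
    using assms(1,2) elements_disjoint by blast
  then show ?thesis
  proof cases
    case 1
    then obtain s k s' k' where A: "A = vertical_third s k" "s \<in> {-1, 1}" "k \<in> {-1, 0, 1}"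
      and B: "B = vertical_third s' k'" "s' \<in> {-1, 1}" "k' \<in> {-1, 0, 1}"
      unfolding vertical_elements_def by blast
    have "s \<noteq> s' \<or> k \<noteq> k'" using assms(3) A B by auto
    then have "A \<inter> B \<subseteq> {pt s (1/3), pt s (-1/3)}"
      using thirds_overlap[OF A(3) B(3)] unfolding A(1) B(1) vertical_third_def
      by (force simp: vec2_eq_iff)
    then show ?thesis by (rule finite_subset) simp
  next
    case 2
    then have "A \<inter> B = {}"
      using assms(3) by (auto simp: horizontal_elements_def horizontal_side_def)
    then show ?thesis by simp
  qed simp
qed

lemma finite_elements: "finite vertical_elements" "finite horizontal_elements"
proof -
  have "vertical_elements \<subseteq> (\<lambda>(s, k). vertical_third s k) ` ({-1, 1} \<times> {-1, 0, 1})"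
    unfolding vertical_elements_def by (auto simp only: image_iff split: prod.split)
  then show "finite vertical_elements" by (rule finite_subset) simp
  have "horizontal_elements \<subseteq> horizontal_side ` {-1, 1}"
    unfolding horizontal_elements_def by blast
  then show "finite horizontal_elements" by (rule finite_subset) simp
qed

lemma strong_Markov_partition_square:
  "strong_Markov_partition square_boundary return_map (vertical_elements \<union> horizontal_elements)"
    (is "strong_Markov_partition ?X ?T ?M")
  unfolding strong_Markov_partition_def
proof (intro conjI ballI impI)
  show "finite ?M" using finite_elements by simp
  show "\<Union> ?M = ?X" by (rule Union_elements)
next
  fix A B assume "A \<in> ?M" "B \<in> ?M" "A \<noteq> B"
  \<comment> \<open>Interior commutes with binary intersection, and a finite intersection has empty
    interior.\<close>
  then show "top_of_set ?X interior_of A \<inter> top_of_set ?X interior_of B = {}"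
    using square_boundary_interior_finite elements_overlap_finite
    by (simp flip: interior_of_Int)
next
  fix A assume "A \<in> ?M"
  then consider
    (vertical) s k where "A = vertical_third s k" "s \<in> {-1, 1}" "k \<in> {-1, 0, 1}"
    | (horizontal) s where "A = horizontal_side s" "s \<in> {-1, 1}"
    unfolding vertical_elements_def horizontal_elements_def by blast
  then have "connected A \<and> top_of_set ?X interior_of A \<noteq> {} \<and>
      finite (top_of_set ?X frontier_of A) \<and> (\<exists>\<N>\<subseteq>?M. ?T ` A = \<Union> \<N>) \<and>
      (\<exists>g. homeomorphism A (?T ` A) ?T g)"
  proof cases
    case vertical
    \<comment> \<open>A box degenerate in the first coordinate, hence convex.\<close>
    have "A = cbox (pt s (2 * k / 3 - 1 / 3)) (pt s (2 * k / 3 + 1 / 3))"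
      by (auto simp: vertical(1) vertical_third_def mem_box_cart forall_2 abs_if split: if_splits)
    then have "connected A" by (simp add: convex_connected convex_box)
    moreover have "\<exists>\<N>\<subseteq>?M. ?T ` A = \<Union> \<N>"
    proof (intro exI conjI)
      have "- s \<in> {-1, 1}" using vertical(2) by auto
      then show "{vertical_third (- s) j | j. j \<in> {-1, 0, 1}} \<subseteq> ?M"
        using vertical_elementsI by blast
      show "?T ` A = \<Union> {vertical_third (- s) j | j. j \<in> {-1, 0, 1}}"
        unfolding vertical(1) vertical_thirds_cover
        by (rule return_map_image_vertical_third[OF vertical(2,3)])
    qed
    moreover note vertical_third_topology[OF vertical(2,3), folded vertical(1)]
    moreover have "\<exists>g. homeomorphism A (?T ` A) ?T g"
      using return_map_vertical_third[OF vertical(2,3)] vertical(1)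
      by (intro homeomorphism_diagonal_affine[of "-1" "if k = 0 then 3 else -3" _ _ "2 * k"]) auto
    ultimately show ?thesis by (intro conjI)
  next
    case horizontal
    have "x \<in> (\<lambda>t. pt t s) ` {-1<..<1}" if "x \<in> A" for x
      using that by (intro image_eqI[of _ _ "x $ 1"])
        (auto simp: horizontal(1) horizontal_side_def vec2_eq_iff)
    then have "A = (\<lambda>t. pt t s) ` {-1<..<1}"
      by (auto simp: horizontal(1) horizontal_side_def)
    then have "connected A"
      by (simp add: connected_continuous_image continuous_on_pt)
    moreover have "horizontal_side (- s) \<in> ?M"
      using horizontal(2) by (auto simp: horizontal_elements_def)
    then have "\<exists>\<N>\<subseteq>?M. ?T ` A = \<Union> \<N>"
      using return_map_image_horizontal_side horizontal
      by (intro exI[of _ "{horizontal_side (- s)}"]) auto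
    moreover have "\<exists>g. homeomorphism A (?T ` A) ?T g"
      using return_map_horizontal_side[OF horizontal(2)] horizontal(1)
      by (intro homeomorphism_diagonal_affine[of 1 "-1" _ _ 0]) auto
    moreover note horizontal_side_topology[OF horizontal(2), folded horizontal(1)]
    ultimately show ?thesis by (intro conjI)
  qed
  then show "connected A" "top_of_set ?X interior_of A \<noteq> {}"
      "finite (top_of_set ?X frontier_of A)" "\<exists>\<N>\<subseteq>?M. ?T ` A = \<Union> \<N>"
      "\<exists>g. homeomorphism A (?T ` A) ?T g"
    by blast+
qed

section \<open>The components of transitivity\<close>

lemma return_map_preserves:
  shows "return_map ` \<Union> vertical_elements \<subseteq> \<Union> vertical_elements"
    and "return_map ` \<Union> horizontal_elements \<subseteq> \<Union> horizontal_elements"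
proof -
  have "\<Union> vertical_elements \<subseteq> square_boundary" "\<Union> horizontal_elements \<subseteq> square_boundary"
    using Union_elements by auto
  then show "return_map ` \<Union> vertical_elements \<subseteq> \<Union> vertical_elements"
    and "return_map ` \<Union> horizontal_elements \<subseteq> \<Union> horizontal_elements"
    unfolding Union_vertical_elements Union_horizontal_elements
    by (auto simp: return_map_eq subset_iff bounce_def abs_zigzag_le)
qed

lemma funpow_image_subset: "T ` S \<subseteq> S \<Longrightarrow> (T ^^ n) ` S \<subseteq> S"
  by (induction n) auto

text \<open>The two kinds have disjoint unions, each mapped into itself, so no iterate of an element
  meets an element of the other kind.\<close>

lemma leads_to_same_kind:
  assumes "leads_to square_boundary return_map (vertical_elements \<union> horizontal_elements) A B"
  shows "A \<in> vertical_elements \<longleftrightarrow> B \<in> vertical_elements"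
proof -
  obtain n where A: "A \<in> vertical_elements \<union> horizontal_elements"
    and B: "B \<in> vertical_elements \<union> horizontal_elements"
    and "top_of_set square_boundary interior_of ((return_map ^^ n) ` A \<inter> B) \<noteq> {}"
    using assms unfolding leads_to_def by blast
  then obtain x where x: "x \<in> (return_map ^^ n) ` A" "x \<in> B"
    using interior_of_subset by fastforce
  show ?thesis
  proof (cases "A \<in> vertical_elements")
    case True
    then have "x \<in> \<Union> vertical_elements"
      using x(1) funpow_image_subset[OF return_map_preserves(1), of n] by blast
    then show ?thesis using True x(2) B elements_disjoint by blast
  next
    case False
    then have "x \<in> \<Union> horizontal_elements"
      using A x(1) funpow_image_subset[OF return_map_preserves(2), of n] by blast
    then show ?thesis using False x(2) elements_disjoint by blast
  qed
qed

lemma equivclp_same_kind: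
  assumes "equivclp (leads_to square_boundary return_map (vertical_elements \<union> horizontal_elements)) A B"
  shows "A \<in> vertical_elements \<longleftrightarrow> B \<in> vertical_elements"
  using assms by (induction rule: equivclp_induct) (auto dest: leads_to_same_kind)

lemma leads_toI:
  assumes "A \<in> \<M>" "B \<in> \<M>" "B \<subseteq> T ` A" "top_of_set X interior_of B \<noteq> {}"
  shows "leads_to X T \<M> A B"
proof -
  have "(T ^^ 1) ` A \<inter> B = B" using assms(3) by auto
  then have "top_of_set X interior_of ((T ^^ 1) ` A \<inter> B) \<noteq> {}" using assms(4) by metis
  then show ?thesis unfolding leads_to_def using assms(1,2) zero_less_one by blast
qed

text \<open>As the branches are full, one step reaches all three thirds of the opposite
  side.\<close>

lemma leads_to_vertical:
  assumes "s \<in> {-1, 1}" "k \<in> {-1, 0, 1}" "j \<in> {-1, 0, 1}"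
  shows "leads_to square_boundary return_map (vertical_elements \<union> horizontal_elements)
     (vertical_third s k) (vertical_third (- s) j)"
proof -
  have s: "- s \<in> {-1, 1}" using assms(1) by auto
  have sub: "vertical_third (- s) j \<subseteq> return_map ` vertical_third s k"
    unfolding return_map_image_vertical_third[OF assms(1,2)] vertical_thirds_cover[symmetric]
    using assms(3) by blast
  show ?thesis
    using vertical_elementsI[OF assms(1,2)] vertical_elementsI[OF s assms(3)]
      sub vertical_third_topology(1)[OF s assms(3)]
    by (intro leads_toI UnI1)
qed

lemma leads_to_horizontal:
  assumes "s \<in> {-1, 1}"
  shows "leads_to square_boundary return_map (vertical_elements \<union> horizontal_elements)
     (horizontal_side s) (horizontal_side (- s))"
proof -
  have s: "- s \<in> {-1, 1}" using assms(1) by auto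
  show ?thesis
    using horizontal_elementsI[OF assms] horizontal_elementsI[OF s]
      return_map_image_horizontal_side[OF assms, THEN equalityD2] horizontal_side_topology(1)[OF s]
    by (intro leads_toI UnI2)
qed

lemma vertical_elements_component:
  "vertical_elements \<in>
     transitivity_components square_boundary return_map (vertical_elements \<union> horizontal_elements)"
proof -
  let ?M = "vertical_elements \<union> horizontal_elements"
  let ?R = "leads_to square_boundary return_map ?M"
  let ?A = "vertical_third 1 0"
  have A: "?A \<in> vertical_elements" unfolding vertical_elements_def by blast
  have "equivclp ?R ?A B" if B_in: "B \<in> vertical_elements" for B
  proof -
    obtain s k where B: "B = vertical_third s k" "s \<in> {-1, 1}" "k \<in> {-1, 0, 1}"
      using B_in unfolding vertical_elements_def by blast
    show ?thesis
    proof (cases "s = 1")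
      case True
      \<comment> \<open>Elements on the side of \<open>?A\<close> itself take two steps, through the
        middle third opposite.\<close>
      have "?R ?A (vertical_third (-1) 0)" "?R (vertical_third (-1) 0) B"
        using leads_to_vertical[of 1 0 0] leads_to_vertical[of "-1" 0 k] B True by auto
      then show ?thesis
        by (meson r_into_equivclp equivclp_trans)
    next
      case False
      then have "?R ?A B" using leads_to_vertical[of 1 0 k] B by auto
      then show ?thesis by (rule r_into_equivclp)
    qed
  qed
  then have "vertical_elements = {B \<in> ?M. equivclp ?R ?A B}"
    using equivclp_same_kind[of ?A] A by blast
  then show ?thesis
    using A unfolding transitivity_components_def by blast
qed

lemma horizontal_elements_component:
  "horizontal_elements \<in>
     transitivity_components square_boundary return_map (vertical_elements \<union> horizontal_elements)"
proof -
  let ?M = "vertical_elements \<union> horizontal_elements"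
  let ?R = "leads_to square_boundary return_map ?M"
  let ?A = "horizontal_side 1"
  have A: "?A \<in> horizontal_elements" unfolding horizontal_elements_def by blast
  \<comment> \<open>Disjointness of the unions would still allow a common empty element; the
    midpoint of the side excludes it.\<close>
  have disj: "B \<notin> vertical_elements" if B_in: "B \<in> horizontal_elements" for B
  proof
    assume "B \<in> vertical_elements"
    moreover obtain s where "B = horizontal_side s"
      using B_in unfolding horizontal_elements_def by blast
    then have "pt 0 s \<in> B" by (simp add: horizontal_side_def)
    ultimately have "pt 0 s \<in> \<Union> vertical_elements" by blast
    then show False by (simp add: Union_vertical_elements)
  qed
  have "equivclp ?R ?A B" if B: "B \<in> horizontal_elements" for B
  proof -
    consider "B = ?A" | "B = horizontal_side (- 1)"
      using B unfolding horizontal_elements_def by blast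
    then show ?thesis
      using leads_to_horizontal[of 1] by cases (auto intro: r_into_equivclp)
  qed
  then have "horizontal_elements = {B \<in> ?M. equivclp ?R ?A B}"
    using equivclp_same_kind[of ?A] A disj by blast
  then show ?thesis
    using A unfolding transitivity_components_def by blast
qed

text \<open>The map is an involution here, so \<open>m = 0\<close> and \<open>p = 2\<close> serve
  every point.\<close>

lemma neutral_horizontal: "neutral return_map horizontal_elements"
  unfolding neutral_def
proof
  fix x assume "x \<in> \<Union> horizontal_elements"
  then obtain s where s: "s \<in> {-1, 1}" and x: "x \<in> horizontal_side s"
    unfolding horizontal_elements_def by blast
  have s': "- s \<in> {-1, 1}" using s by auto
  have "return_map x \<in> horizontal_side (- s)"
    using x return_map_image_horizontal_side[OF s] by blast
  then have "return_map (return_map x) = x"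
    by (simp add: return_map_horizontal_side[OF s'] return_map_horizontal_side[OF s x] vec2_eq_iff)
  then have "(return_map ^^ (0 + 2)) x = (return_map ^^ 0) x" by (simp add: numeral_2_eq_2)
  then show "\<exists>m p. 0 < p \<and> (return_map ^^ (m + p)) x = (return_map ^^ m) x"
    by (metis zero_less_numeral)
qed

section \<open>The invariant measure\<close>

text \<open>Change of variables for the indicator of \<open>B\<close>, with the factor kept on the
  left so that no division of extended reals occurs.\<close>

lemma emeasure_lborel_affine_preimage:
  fixes c d :: real
  assumes "B \<in> sets borel" "c \<noteq> 0"
  shows "ennreal \<bar>c\<bar> * emeasure lborel {t. d + c * t \<in> B} = emeasure lborel B"
proof -
  have "emeasure lborel B = (\<integral>\<^sup>+ x. indicator B x \<partial>lborel)" using assms(1) by simp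
  also have "\<dots> = ennreal \<bar>c\<bar> * (\<integral>\<^sup>+ x. indicator B (d + c * x) \<partial>lborel)"
    using assms by (intro nn_integral_real_affine) auto
  also have "(\<integral>\<^sup>+ x. indicator B (d + c * x) \<partial>lborel) =
      (\<integral>\<^sup>+ x. indicator {t. d + c * t \<in> B} x \<partial>lborel)"
    by (simp add: indicator_def)
  also have "\<dots> = emeasure lborel {t. d + c * t \<in> B}"
  proof -
    have "(\<lambda>t. d + c * t) -` B \<inter> space borel \<in> sets borel"
      using assms(1) by (intro measurable_sets[of _ borel borel]) auto
    then have "{t. d + c * t \<in> B} \<in> sets lborel" by (simp add: vimage_def)
    then show ?thesis by simp
  qed
  finally show ?thesis by simp
qed

text \<open>\<open>bounce\<close> in the parameters of the oriented sides: parameter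
  \<open>t\<close> is height \<open>2 * t - 1\<close> on the right and \<open>1 - 2 * t\<close> on
  the left. The reversed orientation flips the sign of \<open>zigzag\<close>.\<close>

definition unit_zigzag :: "real \<Rightarrow> real" where
  "unit_zigzag t = (1 - zigzag (2 * t - 1)) / 2"

lemma unit_zigzag_branches:
  "0 \<le> t \<Longrightarrow> t \<le> 1/3 \<Longrightarrow> unit_zigzag t = 0 + 3 * t"
  "1/3 \<le> t \<Longrightarrow> t \<le> 2/3 \<Longrightarrow> unit_zigzag t = 2 + (-3) * t"
  "2/3 \<le> t \<Longrightarrow> t \<le> 1 \<Longrightarrow> unit_zigzag t = -2 + 3 * t"
  by (simp_all add: unit_zigzag_def zigzag_def abs_if)

text \<open>Each of the three full branches has slope 3 or -3, so it contributes a third of the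
  measure of \<open>B \<inter> {0..1}\<close> to the preimage.\<close>

lemma emeasure_unit_zigzag_preimage:
  assumes B: "B \<in> sets borel"
  shows "emeasure lborel {t \<in> {0..1}. unit_zigzag t \<in> B} = emeasure lborel (B \<inter> {0..1})"
proof -
  \<comment> \<open>With the open interval, \<open>d + c * t \<in> ?B\<close> by itself confines
    \<open>t\<close> to the open third of its branch; hence the three preimages are disjoint, and
    only finitely many points are lost.\<close>
  let ?B = "B \<inter> {0<..<1}"
  let ?P = "\<lambda>c d. {t :: real. d + c * t \<in> ?B}"
  have cont: "continuous_on UNIV unit_zigzag"
    unfolding unit_zigzag_def zigzag_def by (intro continuous_intros) auto
  have Bs: "?B \<in> sets borel" using B by auto
  have P: "?P c d \<in> sets lborel" for c d
  proof -
    have "(\<lambda>t. d + c * t) -` ?B \<inter> space borel \<in> sets borel"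
      using Bs by (intro measurable_sets[of _ borel borel]) auto
    then show ?thesis by (simp add: vimage_def)
  qed
  have S: "{t \<in> {0..1}. unit_zigzag t \<in> B} \<in> sets lborel"
  proof -
    have "unit_zigzag -` B \<inter> space borel \<in> sets borel"
      using B cont by (intro measurable_sets[of _ borel borel] borel_measurable_continuous_onI) auto
    then have "{0..1} \<inter> unit_zigzag -` B \<in> sets lborel" by simp
    then show ?thesis by (simp add: Int_def vimage_def)
  qed
  have fin: "AE t in lborel. t \<notin> {0, 1/3, 2/3, 1 :: real}"
    by (intro AE_not_in finite_imp_null_set_lborel) simp
  have "emeasure lborel {t \<in> {0..1}. unit_zigzag t \<in> B} =
      emeasure lborel (?P 3 0 \<union> ?P (-3) 2 \<union> ?P 3 (-2))"
  proof (rule emeasure_eq_AE)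
    show "AE t in lborel. t \<in> {t \<in> {0..1}. unit_zigzag t \<in> B} \<longleftrightarrow> t \<in> ?P 3 0 \<union> ?P (-3) 2 \<union> ?P 3 (-2)"
      using fin
    proof eventually_elim
      fix t :: real assume t: "t \<notin> {0, 1/3, 2/3, 1}"
      consider "t < 0" | "0 < t" "t < 1/3" | "1/3 < t" "t < 2/3" | "2/3 < t" "t < 1" | "1 < t"
        using t by fastforce
      then show "t \<in> {t \<in> {0..1}. unit_zigzag t \<in> B} \<longleftrightarrow> t \<in> ?P 3 0 \<union> ?P (-3) 2 \<union> ?P 3 (-2)"
        by cases (auto simp: unit_zigzag_branches)
    qed
  qed (intro S sets.Un P)+
  also have "\<dots> = emeasure lborel (?P 3 0) + emeasure lborel (?P (-3) 2) + emeasure lborel (?P 3 (-2))"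
  proof -
    have 1: "(?P 3 0 \<union> ?P (-3) 2) \<inter> ?P 3 (-2) = {}" and 2: "?P 3 0 \<inter> ?P (-3) 2 = {}" by auto
    show ?thesis
      by (simp only: plus_emeasure[OF P P 2] plus_emeasure[OF sets.Un[OF P P] P 1])
  qed
  also have "\<dots> = emeasure lborel ?B"
  proof -
    have "3 * emeasure lborel (?P c d) = emeasure lborel ?B" if "\<bar>c\<bar> = 3" for c d :: real
      using emeasure_lborel_affine_preimage[OF Bs, of c d] that by auto
    moreover have "x + x + x = 3 * x" for x :: ennreal
    proof -
      have "3 = (1 + 1 + 1 :: ennreal)" by simp
      then show ?thesis by (simp only: distrib_right mult_1)
    qed
    \<comment> \<open>The sum is compared after multiplying by 3, which is finite and nonzero and so
      cancels in \<open>ennreal\<close>.\<close>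
    ultimately have
      "3 * (emeasure lborel (?P 3 0) + emeasure lborel (?P (-3) 2) + emeasure lborel (?P 3 (-2))) =
        3 * emeasure lborel ?B"
      by (simp only: distrib_left abs_minus_cancel abs_numeral)
    then show ?thesis unfolding ennreal_mult_cancel_left by simp
  qed
  also have "\<dots> = emeasure lborel (B \<inter> {0..1})"
  proof (rule emeasure_eq_AE)
    show "AE t in lborel. t \<in> ?B \<longleftrightarrow> t \<in> B \<inter> {0..1}"
      using fin by eventually_elim auto
  qed (use B in auto)
  finally show ?thesis .
qed

section \<open>Invariance of length on the vertical sides\<close>

text \<open>The horizontal sides meet \<open>A\<close> at most in corners, a null set; the factors 2
  are the lengths of the vertical sides.\<close>

lemma emeasure_vertical:
  assumes A: "A \<in> sets borel" "A \<subseteq> \<Union> vertical_elements"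
  shows "emeasure (length_measure square) A =
    2 * emeasure lborel {t \<in> {0..1}. pt 1 (2 * t - 1) \<in> A} +
    2 * emeasure lborel {t \<in> {0..1}. pt (-1) (1 - 2 * t) \<in> A}"
proof -
  have dist: "dist (pt a b) (pt c d) = sqrt ((a - c)\<^sup>2 + (b - d)\<^sup>2)" for a b c d
    by (simp add: dist_vec_def L2_set_def sum_2 dist_real_def)
  have null: "emeasure lborel {t \<in> {0..1}. linepath (pt a b) (pt (- a) b) t \<in> A} = 0"
    if "a \<in> {-1, 1}" for a b
  proof -
    have "{t \<in> {0..1}. linepath (pt a b) (pt (- a) b) t \<in> A} \<subseteq> {0, 1}"
      using A(2) that by (auto simp: Union_vertical_elements linepath_pt abs_if subset_iff
          split: if_splits)
    then have "finite {t \<in> {0..1}. linepath (pt a b) (pt (- a) b) t \<in> A}"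
      by (rule finite_subset) simp
    then show ?thesis by (intro null_setsD1 finite_imp_null_set_lborel)
  qed
  show ?thesis
    unfolding emeasure_length_measure[OF A(1)] length_square lessThan_4
    using null[of "-1" "-1"] null[of 1 1]
    by (simp add: dist linepath_pt numeral_2_eq_2[symmetric] numeral_3_eq_3[symmetric]
        real_sqrt_abs2 algebra_simps)
qed

text \<open>Since \<open>zigzag\<close> is odd, the same parameter map serves both
  directions.\<close>

lemma bounce_vertical:
  "bounce (pt 1 (2 * t - 1)) = pt (-1) (1 - 2 * unit_zigzag t)"
  "bounce (pt (-1) (1 - 2 * t)) = pt 1 (2 * unit_zigzag t - 1)"
  using zigzag_uminus[of "2 * t - 1"] by (simp_all add: bounce_def unit_zigzag_def field_simps)

lemma strongly_chaotic_vertical: "strongly_chaotic (length_measure square) return_map vertical_elements"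
proof -
  let ?V = "\<Union> vertical_elements"
  \<comment> \<open>Length itself is the invariant measure, so absolute continuity is
    immediate.\<close>
  define \<mu> where "\<mu> = restrict_space (length_measure square) ?V"
  have "closed ?V"
    unfolding Union_vertical_elements
    by (intro closed_Collect_conj closed_Collect_le closed_Collect_eq continuous_intros)
  then have V: "?V \<in> sets borel" by simp
  have sp: "space \<mu> = ?V" by (simp add: \<mu>_def space_restrict_space)
  have sets_iff: "A \<in> sets \<mu> \<longleftrightarrow> A \<in> sets borel \<and> A \<subseteq> ?V" for A
    unfolding \<mu>_def using V by (subst sets_restrict_space_iff) (simp_all add: conj_commute)
  have em: "emeasure \<mu> A = emeasure (length_measure square) A" if "A \<in> sets \<mu>" for A
  proof -
    have "A \<subseteq> ?V" using that by (simp only: sets_iff)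
    then show ?thesis unfolding \<mu>_def using V by (intro emeasure_restrict_space) simp_all
  qed
  have "\<And>x. x \<in> ?V \<Longrightarrow> return_map x = pt (- x $ 1) (zigzag (x $ 2))"
    using Union_elements by (subst return_map_eq) (auto simp: Union_vertical_elements bounce_def)
  then have "continuous_on ?V return_map \<longleftrightarrow> continuous_on ?V (\<lambda>x. pt (- x $ 1) (zigzag (x $ 2)))"
    by (intro continuous_on_cong) auto
  moreover have "continuous_on ?V (\<lambda>x. pt (- x $ 1) (zigzag (x $ 2)))"
    unfolding zigzag_def by (intro continuous_intros)
  ultimately have "return_map \<in> measurable (restrict_space borel ?V) borel"
    by (simp add: borel_measurable_continuous_on_restrict)
  moreover have "return_map \<in> space (restrict_space borel ?V) \<rightarrow> ?V"
    using return_map_preserves(1) by (simp only: space_restrict_space space_borel) blast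
  ultimately have "return_map \<in> measurable (restrict_space borel ?V) (restrict_space borel ?V)"
    by (intro measurable_restrict_space2)
  moreover have sets_eq: "sets \<mu> = sets (restrict_space borel ?V)"
    by (simp add: \<mu>_def sets_restrict_space)
  ultimately have meas: "return_map \<in> measurable \<mu> \<mu>"
    using measurable_cong_sets by blast
  \<comment> \<open>Two sides of length 2; a total mass that is neither 0 nor infinite.\<close>
  have total: "emeasure \<mu> ?V = 4"
  proof -
    have "{t \<in> {0..1}. pt 1 (2 * t - 1) \<in> ?V} = {0..1}"
      "{t \<in> {0..1}. pt (-1) (1 - 2 * t) \<in> ?V} = {0..1}"
      by (auto simp: Union_vertical_elements abs_le_iff)
    then show ?thesis using V by (simp add: em sets_iff emeasure_vertical)
  qed
  have "distr \<mu> \<mu> return_map = \<mu>"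
  proof (rule measure_eqI)
    fix A assume "A \<in> sets (distr \<mu> \<mu> return_map)"
    then have A: "A \<in> sets \<mu>" by simp
    have A': "return_map -` A \<inter> ?V \<in> sets \<mu>"
      using measurable_sets[OF meas A] sp by simp
    have path_measurable: "{t. pt (f t) (g t) \<in> A} \<in> sets borel"
      if "continuous_on UNIV f" "continuous_on UNIV g" for f g :: "real \<Rightarrow> real"
    proof -
      have "(\<lambda>t. pt (f t) (g t)) \<in> borel_measurable borel"
        using that by (intro borel_measurable_continuous_onI continuous_intros)
      from measurable_sets[OF this, of A] show ?thesis
        using A by (simp add: sets_iff vimage_def)
    qed
    let ?R = "{t. pt 1 (2 * t - 1) \<in> A}" and ?L = "{t. pt (-1) (1 - 2 * t) \<in> A}"
    have RL: "?R \<in> sets borel" "?L \<in> sets borel"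
      by (intro path_measurable continuous_intros)+
    have on_side: "pt 1 (2 * t - 1) \<in> ?V" "pt (-1) (1 - 2 * t) \<in> ?V" if "t \<in> {0..1}" for t
      using that by (auto simp: Union_vertical_elements abs_le_iff)
    have ret: "return_map x = bounce x" if "x \<in> ?V" for x
      using that Union_elements by (intro return_map_eq) auto
    \<comment> \<open>The right part of the preimage comes from the left part of \<open>A\<close>
      and conversely. Each part keeps its measure under \<open>unit_zigzag\<close>, so the two
      summands merely change places.\<close>
    have "{t \<in> {0..1}. pt 1 (2 * t - 1) \<in> return_map -` A \<inter> ?V} =
        {t \<in> {0..1}. unit_zigzag t \<in> ?L}"
      using on_side by (auto simp: ret bounce_vertical)
    moreover have "{t \<in> {0..1}. pt (-1) (1 - 2 * t) \<in> return_map -` A \<inter> ?V} =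
        {t \<in> {0..1}. unit_zigzag t \<in> ?R}"
      using on_side by (auto simp: ret bounce_vertical)
    ultimately have "emeasure \<mu> (return_map -` A \<inter> ?V) =
        2 * emeasure lborel (?L \<inter> {0..1}) + 2 * emeasure lborel (?R \<inter> {0..1})"
      using A' RL by (simp only: em sets_iff emeasure_vertical emeasure_unit_zigzag_preimage)
    also have "\<dots> = emeasure \<mu> A"
      using A by (simp add: em sets_iff emeasure_vertical Int_def conj_commute add.commute)
    finally show "emeasure (distr \<mu> \<mu> return_map) A = emeasure \<mu> A"
      using emeasure_distr[OF meas A] sp by simp
  qed simp
  moreover have "finite_measure \<mu>" by (rule finite_measureI) (simp add: sp total)
  moreover have "absolutely_continuous (restrict_space (length_measure square) ?V) \<mu>"
    by (simp add: \<mu>_def absolutely_continuous_def)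
  ultimately show ?thesis
    unfolding strongly_chaotic_def using meas sets_eq total sp by (intro exI[of _ \<mu>]) simp
qed

section \<open>Assembly of the example\<close>

theorem theorem2p2:
  shows "\<exists>(ps :: (real^2) list) (v :: real^2 \<Rightarrow> real^2) (X :: (real^2) set) (T :: real^2 \<Rightarrow> real^2) \<M>.
    simple_polygon ps \<and> pseudo_billiard (polygon_region ps) v \<and>
    X = sides_union ps \<and> T = first_return X v \<and>
    \<not> continuous_on X T \<and>
    strong_Markov_partition X T \<M> \<and>
    (\<exists>K \<in> transitivity_components X T \<M>. \<exists>K' \<in> transitivity_components X T \<M>.
       K \<noteq> K' \<and> strongly_chaotic (length_measure ps) T K \<and> neutral T K')"
proof (intro exI conjI bexI)
  show "vertical_elements \<noteq> horizontal_elements"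
  proof
    assume "vertical_elements = horizontal_elements"
    then have "\<Union> vertical_elements = {}" using elements_disjoint by simp
    moreover have "pt 1 0 \<in> \<Union> vertical_elements" by (simp add: Union_vertical_elements)
    ultimately show False by blast
  qed
  show "square_boundary = sides_union square" by (simp add: sides_union_square)
  show "return_map = first_return square_boundary bounce_field" by (rule return_map_def)
qed (rule simple_polygon_square pseudo_billiard_square not_continuous_return_map
      strong_Markov_partition_square vertical_elements_component horizontal_elements_component
      strongly_chaotic_vertical neutral_horizontal)+

end
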